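(* The ring $\mathbf{Racks}^{\mathrm{ab}}\cong\mathbb{Z}[\mathrm{A}^{\pm},\mathrm{E}]/(\mathrm{E}^2-\mathrm{E}(1-\mathrm{A}))$ is a pullback of the diagram $$\mathbb{Z}[\mathrm{A}^{\pm}]\xrightarrow{\ \mathrm{A}\mapsto1\ }\mathbb{Z}\xleftarrow{\ \mathrm{A}\mapsto1\ }\mathbb{Z}[\mathrm{A}^{\pm}]$$ of rings.
   Context: $\mathbb{Z}[\mathrm{A}^{\pm}]$ is the ring of Laurent polynomials in $\mathrm{A}$ and $\mathbb{Z}[\mathrm{A}^{\pm},\mathrm{E}]$ is the commutative polynomial ring in $\mathrm{E}$ over it. A rack is a set $R$ with a binary operation $\rhd$ such that each left multiplication $y\mapsto x\rhd y$ is an automorphism of $(R,\rhd)$. An abelian rack is a rack that is also an abelian group such that $\rhd\colon R\times R\to R$ is a homomorphism of abelian groups. $\mathbf{Racks}^{\mathrm{ab}}$ denotes the ring whose category of modules is equivalent to the category of abelian racks (the endomorphism ring of the abelianization of the free rack of rank $1$). It is known that this ring is $\mathbb{Z}[\mathrm{A}^{\pm},\mathrm{E}]/(\mathrm{E}^2-\mathrm{E}(1-\mathrm{A}))$, a module $M$ over it being an abelian rack via $x\rhd y=\mathrm{E}x+\mathrm{A}y$. *)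

theory Defs
  imports "HOL-Algebra.Algebra" "HOL-Algebra.Algebraic_Closure_Type"
    "HOL-Library.Poly_Mapping"
begin

section \<open>Racks and abelian racks\<close>

class rack =
  fixes rhd :: "'a \<Rightarrow> 'a \<Rightarrow> 'a" (infixr "\<rhd>" 70)
  assumes rhd_bij: "bij (\<lambda>y. x \<rhd> y)"
    and rhd_rhd: "x \<rhd> (y \<rhd> z) = (x \<rhd> y) \<rhd> (x \<rhd> z)"

text \<open>The last axiom says that the rack operation is a homomorphism of abelian groups from
  the direct square of the group to the group.\<close>

class abelian_rack = ab_group_add + rack +
  assumes rhd_add: "(x + x') \<rhd> (y + y') = (x \<rhd> y) + (x' \<rhd> y')"

definition rack_hom :: "('a::rack \<Rightarrow> 'b::rack) \<Rightarrow> bool"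
  where "rack_hom f \<longleftrightarrow> (\<forall>x y. f (x \<rhd> y) = f x \<rhd> f y)"

definition abelian_rack_hom :: "('a::abelian_rack \<Rightarrow> 'b::abelian_rack) \<Rightarrow> bool"
  where "abelian_rack_hom f \<longleftrightarrow> rack_hom f \<and> (\<forall>x y. f (x + y) = f x + f y)"

definition rdiv :: "'a::rack \<Rightarrow> 'a \<Rightarrow> 'a"
  where "rdiv x = inv_into UNIV (\<lambda>y. x \<rhd> y)"

lemma rhd_rdiv [simp]: "x \<rhd> rdiv x y = y"
  unfolding rdiv_def by (rule bij_is_surj[OF rhd_bij, THEN surj_f_inv_f])

lemma rdiv_rhd [simp]: "rdiv x (x \<rhd> y) = y"
  unfolding rdiv_def by (rule inv_f_f[OF bij_is_inj[OF rhd_bij]])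

lemma rack_hom_rdiv: "rack_hom f \<Longrightarrow> f (rdiv x y) = rdiv (f x) (f y)"
  unfolding rack_hom_def by (metis rdiv_rhd rhd_rdiv)


section \<open>The free rack on a set of generators\<close>

text \<open>Racks form a variety: the inverses of the left multiplications are given by a second
  operation, written \<open>RDiv\<close> on terms. The free rack consists of terms modulo the
  least congruence containing the axioms.\<close>

datatype 'x rack_term =
    RGen 'x
  | RRhd "'x rack_term" "'x rack_term"
  | RDiv "'x rack_term" "'x rack_term"

inductive rack_eq :: "'x rack_term \<Rightarrow> 'x rack_term \<Rightarrow> bool" where
  refl: "rack_eq s s"
| sym: "rack_eq s t \<Longrightarrow> rack_eq t s"
| trans: "rack_eq s t \<Longrightarrow> rack_eq t u \<Longrightarrow> rack_eq s u"
| cong_rhd: "rack_eq s s' \<Longrightarrow> rack_eq t t' \<Longrightarrow> rack_eq (RRhd s t) (RRhd s' t')"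
| cong_div: "rack_eq s s' \<Longrightarrow> rack_eq t t' \<Longrightarrow> rack_eq (RDiv s t) (RDiv s' t')"
| rhd_div: "rack_eq (RRhd s (RDiv s t)) t"
| div_rhd: "rack_eq (RDiv s (RRhd s t)) t"
| distrib: "rack_eq (RRhd s (RRhd t u)) (RRhd (RRhd s t) (RRhd s u))"

quotient_type 'x free_rack = "'x rack_term" / rack_eq
  by (intro equivpI reflpI sympI transpI) (fact rack_eq.refl, erule rack_eq.sym, erule (1) rack_eq.trans)

lift_definition free_rack_gen :: "'x \<Rightarrow> 'x free_rack" is RGen .

lift_definition free_rack_div :: "'x free_rack \<Rightarrow> 'x free_rack \<Rightarrow> 'x free_rack" is RDiv
  by (rule rack_eq.cong_div)

instantiation free_rack :: (type) rack
begin

lift_definition rhd_free_rack :: "'x free_rack \<Rightarrow> 'x free_rack \<Rightarrow> 'x free_rack" is RRhd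
  by (rule rack_eq.cong_rhd)

instance
proof
  fix x y z :: "'x free_rack"
  have "x \<rhd> free_rack_div x y = y" for y
    by transfer (rule rack_eq.rhd_div)
  moreover have "free_rack_div x (x \<rhd> y) = y" for y
    by transfer (rule rack_eq.div_rhd)
  ultimately show "bij (\<lambda>y. x \<rhd> y)"
    by (intro o_bij[where g = "free_rack_div x"]) auto
  show "x \<rhd> (y \<rhd> z) = (x \<rhd> y) \<rhd> (x \<rhd> z)"
    by transfer (rule rack_eq.distrib)
qed

end

primrec rack_term_eval :: "('x \<Rightarrow> 'r::rack) \<Rightarrow> 'x rack_term \<Rightarrow> 'r" where
  "rack_term_eval f (RGen a) = f a"
| "rack_term_eval f (RRhd s t) = rack_term_eval f s \<rhd> rack_term_eval f t"
| "rack_term_eval f (RDiv s t) = rdiv (rack_term_eval f s) (rack_term_eval f t)"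

theorem free_rack_universal:
  fixes f :: "'x \<Rightarrow> 'r::rack"
  shows "\<exists>!g. rack_hom g \<and> (\<forall>a. g (free_rack_gen a) = f a)"
proof -
  have eq: "rack_term_eval f s = rack_term_eval f t" if "rack_eq s t" for s t
    using that
  proof induction
    case (distrib s t u)
    show ?case unfolding rack_term_eval.simps by (rule rhd_rhd)
  qed simp_all
  define g where "g = (\<lambda>U. rack_term_eval f (rep_free_rack U))"
  have g: "g (abs_free_rack t) = rack_term_eval f t" for t
    unfolding g_def by (intro eq rep_abs_rsp_left[OF Quotient3_free_rack] rack_eq.refl)
  have ex: "\<exists>t. U = abs_free_rack t" for U :: "'x free_rack"
    by (rule exI[of _ "rep_free_rack U"]) (simp add: Quotient3_abs_rep[OF Quotient3_free_rack])
  have hom: "rack_hom g"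
    unfolding rack_hom_def
  proof (intro allI)
    fix U V :: "'x free_rack"
    obtain s t where "U = abs_free_rack s" "V = abs_free_rack t"
      using ex by metis
    then show "g (U \<rhd> V) = g U \<rhd> g V"
      by (simp add: g rhd_free_rack.abs_eq)
  qed
  have gen: "g (free_rack_gen a) = f a" for a
    by (simp add: g free_rack_gen.abs_eq)
  have uniq: "h = g" if h: "rack_hom h" "\<forall>a. h (free_rack_gen a) = f a" for h
  proof
    fix U :: "'x free_rack"
    have "h (abs_free_rack t) = rack_term_eval f t" for t
    proof (induction t)
      case (RGen a)
      then show ?case using h(2) by (simp flip: free_rack_gen.abs_eq)
    next
      case (RRhd s t)
      then show ?case using h(1) by (simp add: rack_hom_def flip: rhd_free_rack.abs_eq)
    next
      case (RDiv s t)
      have "abs_free_rack s \<rhd> abs_free_rack (RDiv s t) = abs_free_rack t"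
        by (simp add: rhd_free_rack.abs_eq free_rack.abs_eq_iff rack_eq.rhd_div)
      then have "h (abs_free_rack s) \<rhd> h (abs_free_rack (RDiv s t)) = h (abs_free_rack t)"
        using h(1) by (metis rack_hom_def)
      then show ?case using RDiv by (metis rack_term_eval.simps(3) rdiv_rhd)
    qed
    then show "h U = g U"
      using g ex by metis
  qed
  show ?thesis using hom gen uniq by blast
qed


section \<open>The abelianization of a rack\<close>

text \<open>The abelianization is the left adjoint to the forgetful functor from abelian racks to
  racks. It is the abelian rack presented by the elements of the rack as generators,
  subject to the values of the rack operation as relations (rule \<open>gen\<close> below).\<close>

datatype 'r ab_term =
    AGen 'r
  | AZero
  | AAdd "'r ab_term" "'r ab_term"
  | ANeg "'r ab_term"
  | ARhd "'r ab_term" "'r ab_term"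
  | ADiv "'r ab_term" "'r ab_term"

inductive ab_eq :: "'r::rack ab_term \<Rightarrow> 'r ab_term \<Rightarrow> bool" where
  refl: "ab_eq s s"
| sym: "ab_eq s t \<Longrightarrow> ab_eq t s"
| trans: "ab_eq s t \<Longrightarrow> ab_eq t u \<Longrightarrow> ab_eq s u"
| cong_add: "ab_eq s s' \<Longrightarrow> ab_eq t t' \<Longrightarrow> ab_eq (AAdd s t) (AAdd s' t')"
| cong_neg: "ab_eq s s' \<Longrightarrow> ab_eq (ANeg s) (ANeg s')"
| cong_rhd: "ab_eq s s' \<Longrightarrow> ab_eq t t' \<Longrightarrow> ab_eq (ARhd s t) (ARhd s' t')"
| cong_div: "ab_eq s s' \<Longrightarrow> ab_eq t t' \<Longrightarrow> ab_eq (ADiv s t) (ADiv s' t')"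
| assoc: "ab_eq (AAdd (AAdd s t) u) (AAdd s (AAdd t u))"
| comm: "ab_eq (AAdd s t) (AAdd t s)"
| zero: "ab_eq (AAdd AZero s) s"
| neg: "ab_eq (AAdd (ANeg s) s) AZero"
| rhd_div: "ab_eq (ARhd s (ADiv s t)) t"
| div_rhd: "ab_eq (ADiv s (ARhd s t)) t"
| distrib: "ab_eq (ARhd s (ARhd t u)) (ARhd (ARhd s t) (ARhd s u))"
| rhd_add: "ab_eq (ARhd (AAdd s s') (AAdd t t')) (AAdd (ARhd s t) (ARhd s' t'))"
| gen: "ab_eq (AGen (x \<rhd> y)) (ARhd (AGen x) (AGen y))"

quotient_type (overloaded) 'r abelianization = "'r::rack ab_term" / ab_eq
  by (intro equivpI reflpI sympI transpI) (fact ab_eq.refl, erule ab_eq.sym, erule (1) ab_eq.trans)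

lift_definition abelianization_unit :: "'r::rack \<Rightarrow> 'r abelianization" is AGen .

lift_definition abelianization_div ::
  "'r::rack abelianization \<Rightarrow> 'r abelianization \<Rightarrow> 'r abelianization" is ADiv
  by (rule ab_eq.cong_div)

instantiation abelianization :: (rack) abelian_rack
begin

lift_definition zero_abelianization :: "'r::rack abelianization" is AZero .

lift_definition plus_abelianization ::
  "'r::rack abelianization \<Rightarrow> 'r abelianization \<Rightarrow> 'r abelianization" is AAdd
  by (rule ab_eq.cong_add)

lift_definition uminus_abelianization :: "'r::rack abelianization \<Rightarrow> 'r abelianization" is ANeg
  by (rule ab_eq.cong_neg)

definition minus_abelianization ::
  "'r::rack abelianization \<Rightarrow> 'r abelianization \<Rightarrow> 'r abelianization"
  where "minus_abelianization x y = x + (- y)"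

lift_definition rhd_abelianization ::
  "'r::rack abelianization \<Rightarrow> 'r abelianization \<Rightarrow> 'r abelianization" is ARhd
  by (rule ab_eq.cong_rhd)

instance
proof
  fix x x' y y' z :: "'r::rack abelianization"
  show "x + y + z = x + (y + z)" by transfer (rule ab_eq.assoc)
  show "x + y = y + x" by transfer (rule ab_eq.comm)
  show "0 + x = x" by transfer (rule ab_eq.zero)
  show "- x + x = 0" by transfer (rule ab_eq.neg)
  show "x - y = x + (- y)" by (rule minus_abelianization_def)
  have "x \<rhd> abelianization_div x y = y" for y
    by transfer (rule ab_eq.rhd_div)
  moreover have "abelianization_div x (x \<rhd> y) = y" for y
    by transfer (rule ab_eq.div_rhd)
  ultimately show "bij (\<lambda>y. x \<rhd> y)"
    by (intro o_bij[where g = "abelianization_div x"]) auto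
  show "x \<rhd> (y \<rhd> z) = (x \<rhd> y) \<rhd> (x \<rhd> z)" by transfer (rule ab_eq.distrib)
  show "(x + x') \<rhd> (y + y') = (x \<rhd> y) + (x' \<rhd> y')" by transfer (rule ab_eq.rhd_add)
qed

end

primrec ab_term_eval :: "('r \<Rightarrow> 'm::abelian_rack) \<Rightarrow> 'r ab_term \<Rightarrow> 'm" where
  "ab_term_eval f (AGen a) = f a"
| "ab_term_eval f AZero = 0"
| "ab_term_eval f (AAdd s t) = ab_term_eval f s + ab_term_eval f t"
| "ab_term_eval f (ANeg s) = - ab_term_eval f s"
| "ab_term_eval f (ARhd s t) = ab_term_eval f s \<rhd> ab_term_eval f t"
| "ab_term_eval f (ADiv s t) = rdiv (ab_term_eval f s) (ab_term_eval f t)"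

theorem abelianization_universal:
  fixes f :: "'r::rack \<Rightarrow> 'm::abelian_rack"
  assumes f: "rack_hom f"
  shows "\<exists>!g. abelian_rack_hom g \<and> (\<forall>a. g (abelianization_unit a) = f a)"
proof -
  have eq: "ab_term_eval f s = ab_term_eval f t" if "ab_eq s t" for s t
    using that
  proof induction
    case (distrib s t u)
    show ?case unfolding ab_term_eval.simps by (rule rhd_rhd)
  next
    case (rhd_add s s' t t')
    show ?case unfolding ab_term_eval.simps by (rule abelian_rack_class.rhd_add)
  next
    case (gen x y)
    show ?case using f by (simp add: rack_hom_def)
  next
    case (comm s t)
    show ?case by (simp add: add.commute)
  qed (simp_all add: add.assoc)
  define g where "g = (\<lambda>U. ab_term_eval f (rep_abelianization U))"
  have g: "g (abs_abelianization t) = ab_term_eval f t" for t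
    unfolding g_def by (intro eq rep_abs_rsp_left[OF Quotient3_abelianization] ab_eq.refl)
  have ex: "\<exists>t. U = abs_abelianization t" for U :: "'r abelianization"
    by (rule exI[of _ "rep_abelianization U"])
      (simp add: Quotient3_abs_rep[OF Quotient3_abelianization])
  have hom: "abelian_rack_hom g"
    unfolding abelian_rack_hom_def rack_hom_def
  proof (intro allI conjI)
    fix U V :: "'r abelianization"
    obtain s t where "U = abs_abelianization s" "V = abs_abelianization t"
      using ex by metis
    then show "g (U \<rhd> V) = g U \<rhd> g V" "g (U + V) = g U + g V"
      by (simp_all add: g rhd_abelianization.abs_eq plus_abelianization.abs_eq)
  qed
  have gen: "g (abelianization_unit a) = f a" for a
    by (simp add: g abelianization_unit.abs_eq)
  have uniq: "h = g"
    if h: "abelian_rack_hom h" "\<forall>a. h (abelianization_unit a) = f a" for h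
  proof
    fix U :: "'r abelianization"
    have rh: "rack_hom h" and add: "h (x + y) = h x + h y" for x y
      using h(1) by (auto simp: abelian_rack_hom_def)
    have zero: "h 0 = 0" using add[of 0 0] by simp
    have neg: "h (- x) = - h x" for x
      using add[of "- x" x] zero by (simp add: eq_neg_iff_add_eq_0)
    have "h (abs_abelianization t) = ab_term_eval f t" for t
    proof (induction t)
      case (AGen a)
      then show ?case using h(2) by (simp flip: abelianization_unit.abs_eq)
    next
      case AZero
      then show ?case using zero by (simp flip: zero_abelianization.abs_eq)
    next
      case (AAdd s t)
      then show ?case by (simp add: add flip: plus_abelianization.abs_eq)
    next
      case (ANeg s)
      then show ?case by (simp add: neg flip: uminus_abelianization.abs_eq)
    next
      case (ARhd s t)
      then show ?case using rh by (simp add: rack_hom_def flip: rhd_abelianization.abs_eq)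
    next
      case (ADiv s t)
      have "abs_abelianization s \<rhd> abs_abelianization (ADiv s t) = abs_abelianization t"
        by (simp add: rhd_abelianization.abs_eq abelianization.abs_eq_iff ab_eq.rhd_div)
      then have "h (abs_abelianization s) \<rhd> h (abs_abelianization (ADiv s t))
          = h (abs_abelianization t)"
        using rh by (metis rack_hom_def)
      then show ?case using ADiv by (metis ab_term_eval.simps(6) rdiv_rhd)
    qed
    then show "h U = g U" using g ex by metis
  qed
  show ?thesis using hom gen uniq by blast
qed

lemma rack_hom_abelianization_unit: "rack_hom abelianization_unit"
  unfolding rack_hom_def by (intro allI, transfer) (rule ab_eq.gen)


section \<open>The ring of abelian racks\<close>

definition abelian_rack_End :: "('m::abelian_rack \<Rightarrow> 'm) ring"
  where "abelian_rack_End =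
    \<lparr>carrier = Collect abelian_rack_hom, monoid.mult = (\<circ>), one = id,
     ring.zero = (\<lambda>_. 0), add = (\<lambda>f g x. f x + g x)\<rparr>"

definition Racks_ab ::
    "(unit free_rack abelianization \<Rightarrow> unit free_rack abelianization) ring"
  where "Racks_ab = abelian_rack_End"


section \<open>Laurent polynomials and the presentation\<close>

text \<open>The multiplication of \<^typ>\<open>int \<Rightarrow>\<^sub>0 int\<close> is convolution, so this type is the integral
  group ring of the infinite cyclic group, i.e. the ring of integral Laurent polynomials;
  \<open>Poly_Mapping.single n c\<close> is \<open>c A^n\<close>.\<close>

type_synonym laurent = "int \<Rightarrow>\<^sub>0 int"

definition LA :: laurent
  where "LA = Poly_Mapping.single 1 1"

abbreviation Laurent_ring :: "laurent ring"
  where "Laurent_ring \<equiv> ring_of_type_algebra"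

abbreviation LaurentE_ring :: "laurent poly ring"
  where "LaurentE_ring \<equiv> ring_of_type_algebra"

text \<open>In \<^typ>\<open>laurent poly\<close> the polynomial variable \<open>[:0, 1:]\<close> is E.\<close>

definition rack_relation :: "laurent poly"
  where "rack_relation = [:0, 1:]^2 - [:0, 1:] * [:1 - LA:]"

definition AE_quotient :: "laurent poly set ring"
  where "AE_quotient = LaurentE_ring Quot (PIdl\<^bsub>LaurentE_ring\<^esub> rack_relation)"

text \<open>Evaluation of a Laurent polynomial at A = 1 is the sum of its coefficients.\<close>

definition laurent_at_1 :: "laurent \<Rightarrow> int"
  where "laurent_at_1 p = (\<Sum>k\<in>Poly_Mapping.keys p. Poly_Mapping.lookup p k)"

lemma laurent_at_1_LA: "laurent_at_1 LA = 1"
  by (simp add: laurent_at_1_def LA_def)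

text \<open>The substitution of e for E, on residue classes. It is well defined when
  \<open>e^2 = e (1 - A)\<close>.\<close>

definition subst_E :: "laurent \<Rightarrow> laurent poly set \<Rightarrow> laurent"
  where "subst_E e C = the_elem ((\<lambda>p. Polynomial.poly p e) ` C)"


section \<open>Pullbacks of rings\<close>

text \<open>P together with p and q is a pullback of f and g in the category of unital rings.
  A definition cannot quantify over the types of the test rings T, so that type is a
  parameter; theorems are to leave it a free type variable.\<close>

definition is_ring_pullback ::
  "'t itself \<Rightarrow> ('a, 'm) ring_scheme \<Rightarrow> ('b, 'n) ring_scheme \<Rightarrow> ('c, 'k) ring_scheme \<Rightarrow>
   ('a \<Rightarrow> 'c) \<Rightarrow> ('b \<Rightarrow> 'c) \<Rightarrow> ('p, 'l) ring_scheme \<Rightarrow> ('p \<Rightarrow> 'a) \<Rightarrow> ('p \<Rightarrow> 'b) \<Rightarrow> bool"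
  where "is_ring_pullback _ R S Z f g P p q \<longleftrightarrow>
    ring R \<and> ring S \<and> ring Z \<and> ring P \<and>
    f \<in> ring_hom R Z \<and> g \<in> ring_hom S Z \<and>
    p \<in> ring_hom P R \<and> q \<in> ring_hom P S \<and>
    (\<forall>x\<in>carrier P. f (p x) = g (q x)) \<and>
    (\<forall>(T :: 't ring) u v.
       ring T \<and> u \<in> ring_hom T R \<and> v \<in> ring_hom T S \<and>
       (\<forall>t\<in>carrier T. f (u t) = g (v t)) \<longrightarrow>
       (\<exists>h\<in>ring_hom T P.
          (\<forall>t\<in>carrier T. p (h t) = u t \<and> q (h t) = v t) \<and>
          (\<forall>k\<in>ring_hom T P.
             (\<forall>t\<in>carrier T. p (k t) = u t \<and> q (k t) = v t) \<longrightarrow>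
             (\<forall>t\<in>carrier T. k t = h t))))"

end

theory Submission
  imports Defs
begin

text \<open>Both rings of the proposition are identified with the concrete fibre product of pairs
  \<open>(a, b)\<close> of Laurent polynomials with \<open>a(1) = b(1)\<close>, for which the pullback property is
  evident. By \<open>is_ring_pullback_of_ring_iso\<close> the pullback property passes to every ring
  isomorphic to the fibre product.

  For the presented ring, substitute the two roots \<open>0\<close> and \<open>1 - A\<close> of \<open>E^2 - E (1 - A)\<close> for
  \<open>E\<close>. A polynomial vanishes at both roots iff the relation divides it, because \<open>1 - A\<close> is not
  a zero divisor. The pairs of values are exactly those that agree at \<open>A = 1\<close>: the two
  roots coincide there, and conversely a Laurent polynomial that vanishes at \<open>A = 1\<close> is divisible
  by \<open>1 - A\<close> (\<open>one_minus_LA_dvd_iff\<close>), so that \<open>a + E (b - a) / (1 - A)\<close> has the values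
  \<open>a\<close> and \<open>b\<close>.

  For the ring of abelian racks, write \<open>E x = x \<rhd> 0\<close> and \<open>A x = 0 \<rhd> x\<close>. In every abelian rack
  \<open>x \<rhd> y = E x + A y\<close>, the map \<open>A\<close> is an additive bijection commuting with \<open>E\<close>, and
  \<open>E E + A E = E\<close>. The fibre product is an abelian rack with \<open>E = (0, 1 - A)\<close> and
  \<open>A = (A, A)\<close>, so there is a homomorphism to it from the free abelian rack of rank 1 that sends
  the generator \<open>g\<close> to \<open>1\<close>. Its inverse sends \<open>(a, b)\<close> to \<open>a g + E (c g)\<close> with
  \<open>c = (b - a) / (1 - A)\<close> (\<open>from_to_fibre\<close>, \<open>to_from_fibre\<close>). An endomorphism of the free
  object is determined by the image of \<open>g\<close>, which may be arbitrary, and under the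
  identification with the fibre product it becomes multiplication by this image. Hence the
  endomorphism ring is the fibre product.\<close>

section \<open>Laurent polynomials at \<open>A = 1\<close>\<close>

lemma laurent_at_1_superset:
  assumes "finite K" "Poly_Mapping.keys p \<subseteq> K"
  shows "laurent_at_1 p = (\<Sum>k\<in>K. Poly_Mapping.lookup p k)"
  unfolding laurent_at_1_def
  by (rule sum.mono_neutral_left) (use assms in \<open>auto simp: in_keys_iff\<close>)

lemma laurent_at_1_add: "laurent_at_1 (p + q) = laurent_at_1 p + laurent_at_1 q"
  using Poly_Mapping.keys_add[of p q]
  by (simp add: laurent_at_1_superset[of "Poly_Mapping.keys p \<union> Poly_Mapping.keys q"]
      lookup_add sum.distrib)

lemma laurent_at_1_0 [simp]: "laurent_at_1 0 = 0"
  by (simp add: laurent_at_1_def)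

lemma laurent_at_1_minus: "laurent_at_1 (- p) = - laurent_at_1 p"
  using laurent_at_1_add[of p "- p"] by simp

lemma laurent_at_1_diff: "laurent_at_1 (p - q) = laurent_at_1 p - laurent_at_1 q"
  using laurent_at_1_add[of "p - q" q] by simp

lemma laurent_at_1_single [simp]: "laurent_at_1 (Poly_Mapping.single n c) = c"
  by (simp add: laurent_at_1_def)

lemma laurent_at_1_1 [simp]: "laurent_at_1 1 = 1"
  using laurent_at_1_single[of 0 1] by simp

text \<open>Allowing differences in the induction step makes the monomials with coefficient 1
  suffice, so that additive maps need only be compared on the powers of A.\<close>

lemma laurent_induct [case_names zero monomial diff]:
  fixes p :: laurent
  assumes "P 0" "\<And>n. P (Poly_Mapping.single n 1)" "\<And>p q. P p \<Longrightarrow> P q \<Longrightarrow> P (p - q)"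
  shows "P p"
  by (rule frag_induction[of p UNIV]) (use assms in auto)

lemma laurent_at_1_mult: "laurent_at_1 (p * q) = laurent_at_1 p * laurent_at_1 q"
proof (induction p rule: laurent_induct)
  case (monomial m)
  show ?case
    by (induction q rule: laurent_induct)
      (simp_all add: mult_single right_diff_distrib laurent_at_1_diff)
qed (simp_all add: left_diff_distrib laurent_at_1_diff)

lemma LA_mult_single: "LA * Poly_Mapping.single n c = Poly_Mapping.single (n + 1) c"
  by (simp add: LA_def mult_single add.commute)

lemma LA_neq_1: "1 - LA \<noteq> 0"
proof
  assume "1 - LA = 0"
  then have "Poly_Mapping.single 0 1 = (Poly_Mapping.single 1 1 :: laurent)"
    by (simp add: LA_def)
  then have "Poly_Mapping.lookup (Poly_Mapping.single 0 1 :: laurent) 0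
      = Poly_Mapping.lookup (Poly_Mapping.single 1 1 :: laurent) 0"
    by (rule arg_cong)
  then show False
    by (simp add: lookup_single)
qed

lemma one_minus_LA_dvd_monomial: "1 - LA dvd Poly_Mapping.single n 1 - 1"
proof (induction n rule: int_induct[of _ 0])
  case base
  show ?case by simp
next
  case (step1 n)
  have "Poly_Mapping.single (n + 1) 1 - 1
      = LA * (Poly_Mapping.single n 1 - 1) - (1 - LA)"
    by (simp add: algebra_simps LA_mult_single)
  then show ?case using step1.IH by (metis dvd_diff dvd_mult dvd_refl)
next
  case (step2 n)
  have "Poly_Mapping.single (n - 1) 1 - 1
      = (Poly_Mapping.single n 1 - 1) + (1 - LA) * Poly_Mapping.single (n - 1) 1"
    by (simp add: left_diff_distrib LA_mult_single)
  then show ?case using step2.IH by (metis dvd_add dvd_triv_left)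
qed

text \<open>Modulo \<open>1 - A\<close> every power of A is 1, so every Laurent polynomial is congruent to the
  constant that is its value at \<open>A = 1\<close>.\<close>

lemma one_minus_LA_dvd_iff: "1 - LA dvd p \<longleftrightarrow> laurent_at_1 p = 0"
proof
  assume "1 - LA dvd p"
  then show "laurent_at_1 p = 0"
    by (auto simp: laurent_at_1_mult laurent_at_1_diff laurent_at_1_LA)
next
  have "1 - LA dvd p - Poly_Mapping.single 0 (laurent_at_1 p)"
  proof (induction p rule: laurent_induct)
    case (monomial n)
    then show ?case using one_minus_LA_dvd_monomial by simp
  next
    case (diff p q)
    have "p - q - Poly_Mapping.single 0 (laurent_at_1 (p - q))
        = (p - Poly_Mapping.single 0 (laurent_at_1 p))
          - (q - Poly_Mapping.single 0 (laurent_at_1 q))"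
      by (simp add: laurent_at_1_diff single_diff)
    then show ?case using diff by (metis dvd_diff)
  qed simp
  then show "1 - LA dvd p" if "laurent_at_1 p = 0"
    using that by simp
qed


section \<open>The fibre product\<close>

text \<open>The fibre product is made a type because the universal properties of free racks and
  abelianizations concern targets that are instances of the type class of (abelian) racks.\<close>

typedef fibre_product = "{(a, b). laurent_at_1 a = laurent_at_1 b}"
  by auto

(* Otherwise the lifting of Laurent polynomials to their coefficient functions would take
   precedence in the components of a pair. *)
lifting_forget poly_mapping.lifting

setup_lifting type_definition_fibre_product

lift_definition fp_fst :: "fibre_product \<Rightarrow> laurent" is fst .

lift_definition fp_snd :: "fibre_product \<Rightarrow> laurent" is snd .

lemma fp_eqI: "fp_fst w = fp_fst w' \<Longrightarrow> fp_snd w = fp_snd w' \<Longrightarrow> w = w'"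
  by transfer auto

lemma fp_at_1: "laurent_at_1 (fp_fst w) = laurent_at_1 (fp_snd w)"
  by transfer auto

lemma fp_exists:
  assumes "laurent_at_1 a = laurent_at_1 b"
  obtains w where "fp_fst w = a" "fp_snd w = b"
  using assms that[of "Abs_fibre_product (a, b)"]
  by (simp add: fp_fst.rep_eq fp_snd.rep_eq Abs_fibre_product_inverse)

text \<open>This is where the condition defining the fibre product enters: the second component
  differs from the first by a unique multiple of \<open>1 - A\<close>, so the fibre product is free
  over the Laurent polynomials on \<open>(1, 1)\<close> and \<open>(0, 1 - A)\<close>.
  The second coordinate with respect to this basis is the following quotient.\<close>

definition fp_quot :: "fibre_product \<Rightarrow> laurent"
  where "fp_quot w = (THE c. fp_snd w = fp_fst w + (1 - LA) * c)"

lemma fp_quot_eqI: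
  assumes "fp_snd w = fp_fst w + (1 - LA) * c"
  shows "fp_quot w = c"
  unfolding fp_quot_def
proof (rule the_equality)
  show "d = c" if "fp_snd w = fp_fst w + (1 - LA) * d" for d
    using that assms LA_neq_1 by simp
qed (rule assms)

lemma fp_quot: "fp_snd w = fp_fst w + (1 - LA) * fp_quot w"
proof -
  have "1 - LA dvd fp_snd w - fp_fst w"
    by (simp add: one_minus_LA_dvd_iff laurent_at_1_diff fp_at_1)
  then obtain c where "fp_snd w - fp_fst w = (1 - LA) * c" ..
  then have c: "fp_snd w = fp_fst w + (1 - LA) * c"
    by (simp add: algebra_simps)
  then have "fp_quot w = c" by (rule fp_quot_eqI)
  with c show ?thesis by simp
qed

instantiation fibre_product :: comm_ring_1
begin

lift_definition zero_fibre_product :: fibre_product is "(0, 0)" by simp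
lift_definition one_fibre_product :: fibre_product is "(1, 1)" by simp
lift_definition plus_fibre_product :: "fibre_product \<Rightarrow> fibre_product \<Rightarrow> fibre_product"
  is "\<lambda>(a, b) (c, d). (a + c, b + d)" by (auto simp: laurent_at_1_add)
lift_definition minus_fibre_product :: "fibre_product \<Rightarrow> fibre_product \<Rightarrow> fibre_product"
  is "\<lambda>(a, b) (c, d). (a - c, b - d)" by (auto simp: laurent_at_1_diff)
lift_definition uminus_fibre_product :: "fibre_product \<Rightarrow> fibre_product"
  is "\<lambda>(a, b). (- a, - b)" by (auto simp: laurent_at_1_minus)
lift_definition times_fibre_product :: "fibre_product \<Rightarrow> fibre_product \<Rightarrow> fibre_product"
  is "\<lambda>(a, b) (c, d). (a * c, b * d)" by (auto simp: laurent_at_1_mult)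

instance
  by standard (transfer; auto simp: algebra_simps)+

end

lemma fp_simps [simp]:
  "fp_fst 0 = 0" "fp_snd 0 = 0" "fp_fst 1 = 1" "fp_snd 1 = 1"
  "fp_fst (v + w) = fp_fst v + fp_fst w" "fp_snd (v + w) = fp_snd v + fp_snd w"
  "fp_fst (v * w) = fp_fst v * fp_fst w" "fp_snd (v * w) = fp_snd v * fp_snd w"
  by (transfer; auto)+

text \<open>Here A acts as \<open>(A, A)\<close> and E as \<open>(0, 1 - A)\<close>, one root of \<open>E^2 - E (1 - A)\<close> in each
  component.\<close>

instantiation fibre_product :: abelian_rack
begin

lift_definition rhd_fibre_product :: "fibre_product \<Rightarrow> fibre_product \<Rightarrow> fibre_product"
  is "\<lambda>(a, b) (c, d). (LA * c, (1 - LA) * b + LA * d)"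
  by (auto simp: laurent_at_1_mult laurent_at_1_add laurent_at_1_diff laurent_at_1_LA)

lemma fp_rhd [simp]:
  "fp_fst (v \<rhd> w) = LA * fp_fst w"
  "fp_snd (v \<rhd> w) = (1 - LA) * fp_snd v + LA * fp_snd w"
  by (transfer; auto)+

instance
proof
  fix v v' w w' u :: fibre_product
  \<comment> \<open>the inverse of A\<close>
  define B :: laurent where "B = Poly_Mapping.single (-1) 1"
  have LB: "LA * (B * p) = p" "B * (LA * p) = p" for p
    by (simp_all add: B_def LA_def mult_single flip: mult.assoc)
  have inv: "laurent_at_1 B = 1"
    by (simp add: B_def)
  show "bij (\<lambda>w. v \<rhd> w)"
  proof (rule bijI)
    show "inj (\<lambda>w. v \<rhd> w)"
    proof (rule injI)
      fix w w' assume "v \<rhd> w = v \<rhd> w'"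
      then have "LA * fp_fst w = LA * fp_fst w'" "LA * fp_snd w = LA * fp_snd w'"
        by (metis fp_rhd(1), metis fp_rhd(2) add_left_cancel)
      then show "w = w'"
        by (metis LB(2) fp_eqI)
    qed
    show "surj (\<lambda>w. v \<rhd> w)"
      unfolding surj_def
    proof
      fix w
      obtain u where u: "fp_fst u = B * fp_fst w"
          "fp_snd u = B * (fp_snd w - (1 - LA) * fp_snd v)"
        by (rule fp_exists[of "B * fp_fst w" "B * (fp_snd w - (1 - LA) * fp_snd v)"])
          (simp_all add: laurent_at_1_mult laurent_at_1_diff laurent_at_1_LA inv fp_at_1)
      have "w = v \<rhd> u"
        by (rule fp_eqI) (simp_all only: fp_rhd u LB, simp)
      then show "\<exists>u. w = v \<rhd> u" ..
    qed
  qed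
  show "v \<rhd> (w \<rhd> u) = (v \<rhd> w) \<rhd> (v \<rhd> u)"
    by (rule fp_eqI) (simp_all add: algebra_simps)
  show "(v + v') \<rhd> (w + w') = (v \<rhd> w) + (v' \<rhd> w')"
    by (rule fp_eqI) (simp_all add: algebra_simps)
qed

end

abbreviation Fibre_ring :: "fibre_product ring"
  where "Fibre_ring \<equiv> ring_of_type_algebra"

lemma ring_of_type_algebra_simps [simp]:
  "carrier ring_of_type_algebra = UNIV"
  "x \<otimes>\<^bsub>ring_of_type_algebra\<^esub> y = x * y"
  "x \<oplus>\<^bsub>ring_of_type_algebra\<^esub> y = x + y"
  "\<one>\<^bsub>ring_of_type_algebra\<^esub> = 1"
  "\<zero>\<^bsub>ring_of_type_algebra\<^esub> = 0"
  by (simp_all add: ring_of_type_algebra_def)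


section \<open>Pullbacks\<close>

text \<open>Unique solvability of the fibre equation turns a cone into a map of sets; the map is a
  homomorphism because elements with the same two projections are equal.\<close>

lemma is_ring_pullbackI:
  assumes rings: "ring R" "ring S" "ring Z" "ring P"
    and homs: "f \<in> ring_hom R Z" "g \<in> ring_hom S Z" "p \<in> ring_hom P R" "q \<in> ring_hom P S"
    and comm: "\<And>x. x \<in> carrier P \<Longrightarrow> f (p x) = g (q x)"
    and fibre: "\<And>a b. a \<in> carrier R \<Longrightarrow> b \<in> carrier S \<Longrightarrow> f a = g b \<Longrightarrow>
      \<exists>!x. x \<in> carrier P \<and> p x = a \<and> q x = b"
  shows "is_ring_pullback TYPE('t) R S Z f g P p q"
  unfolding is_ring_pullback_def
proof (intro conjI allI impI ballI)
  fix T :: "'t ring" and u v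
  assume "ring T \<and> u \<in> ring_hom T R \<and> v \<in> ring_hom T S \<and> (\<forall>t\<in>carrier T. f (u t) = g (v t))"
  then have T: "ring T" and u: "u \<in> ring_hom T R" and v: "v \<in> ring_hom T S"
    and uv: "\<And>t. t \<in> carrier T \<Longrightarrow> f (u t) = g (v t)"
    by auto
  define h where "h = (\<lambda>t. THE x. x \<in> carrier P \<and> p x = u t \<and> q x = v t)"
  have h: "h t \<in> carrier P" "p (h t) = u t" "q (h t) = v t" if "t \<in> carrier T" for t
    using theI'[OF fibre[OF ring_hom_closed[OF u that] ring_hom_closed[OF v that] uv[OF that]]]
    by (auto simp: h_def)
  have joint_inj: "x = y" if "x \<in> carrier P" "y \<in> carrier P" "p x = p y" "q x = q y" for x y
    using fibre[OF ring_hom_closed[OF homs(3) that(1)] ring_hom_closed[OF homs(4) that(1)]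
        comm[OF that(1)]] that by metis
  interpret T: ring T by (rule T)
  interpret P: ring P by (rule rings(4))
  have "h \<in> ring_hom T P"
  proof (rule ring_hom_memI)
    fix s t assume st: "s \<in> carrier T" "t \<in> carrier T"
    show "h s \<in> carrier P" by (rule h(1)[OF st(1)])
    show "h (s \<otimes>\<^bsub>T\<^esub> t) = h s \<otimes>\<^bsub>P\<^esub> h t"
      by (rule joint_inj)
        (simp_all add: st h ring_hom_mult[OF homs(3)] ring_hom_mult[OF homs(4)]
          ring_hom_mult[OF u] ring_hom_mult[OF v])
    show "h (s \<oplus>\<^bsub>T\<^esub> t) = h s \<oplus>\<^bsub>P\<^esub> h t"
      by (rule joint_inj)
        (simp_all add: st h ring_hom_add[OF homs(3)] ring_hom_add[OF homs(4)]
          ring_hom_add[OF u] ring_hom_add[OF v])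
  next
    show "h \<one>\<^bsub>T\<^esub> = \<one>\<^bsub>P\<^esub>"
      by (rule joint_inj)
        (simp_all add: h ring_hom_one[OF homs(3)] ring_hom_one[OF homs(4)]
          ring_hom_one[OF u] ring_hom_one[OF v])
  qed
  then show "\<exists>h\<in>ring_hom T P. (\<forall>t\<in>carrier T. p (h t) = u t \<and> q (h t) = v t) \<and>
      (\<forall>k\<in>ring_hom T P. (\<forall>t\<in>carrier T. p (k t) = u t \<and> q (k t) = v t) \<longrightarrow>
        (\<forall>t\<in>carrier T. k t = h t))"
    by (intro bexI[of _ h] conjI ballI impI)
      (auto simp: h intro!: joint_inj dest: ring_hom_closed)
qed (use rings homs comm in auto)

lemma laurent_at_1_ring_hom: "laurent_at_1 \<in> ring_hom Laurent_ring \<Z>"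
  by (rule ring_hom_memI) (auto simp: laurent_at_1_mult laurent_at_1_add)

lemma is_ring_pullback_of_ring_iso:
  assumes P: "ring P" and \<Phi>: "\<Phi> \<in> ring_iso P Fibre_ring"
    and p: "\<And>x. x \<in> carrier P \<Longrightarrow> p x = fp_fst (\<Phi> x)"
    and q: "\<And>x. x \<in> carrier P \<Longrightarrow> q x = fp_snd (\<Phi> x)"
  shows "is_ring_pullback TYPE('t) Laurent_ring Laurent_ring \<Z> laurent_at_1 laurent_at_1 P p q"
proof (rule is_ring_pullbackI)
  interpret P: ring P by (rule P)
  note hom = ring_iso_memE[OF \<Phi>, simplified]
  show "p \<in> ring_hom P Laurent_ring" "q \<in> ring_hom P Laurent_ring"
    by (rule ring_hom_memI; simp add: p q hom)+
  show "\<exists>!x. x \<in> carrier P \<and> p x = a \<and> q x = b" if ab: "laurent_at_1 a = laurent_at_1 b" for a b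
  proof -
    obtain w where w: "fp_fst w = a" "fp_snd w = b"
      by (rule fp_exists[OF ab])
    have "w \<in> \<Phi> ` carrier P" and inj: "inj_on \<Phi> (carrier P)"
      using hom(5) by (auto simp: bij_betw_def)
    then obtain x where x: "x \<in> carrier P" "\<Phi> x = w" by auto
    show ?thesis
      by (rule ex1I[of _ x]) (use x w p q inj in \<open>auto intro!: inj_onD[OF inj] fp_eqI\<close>)
  qed
qed (use P p q fp_at_1 laurent_at_1_ring_hom ring_from_type_algebra int_is_cring in
    \<open>auto intro: cring.axioms(1)\<close>)


section \<open>The presentation by A and E\<close>

definition E_values :: "laurent poly \<Rightarrow> fibre_product"
  where "E_values p = (THE w. fp_fst w = Polynomial.poly p 0 \<and>
    fp_snd w = Polynomial.poly p (1 - LA))"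

text \<open>The two substitutions agree at \<open>A = 1\<close>, since both then put \<open>E = 0\<close>; so the pair of
  values does lie in the fibre product.\<close>

lemma E_values:
  "fp_fst (E_values p) = Polynomial.poly p 0" "fp_snd (E_values p) = Polynomial.poly p (1 - LA)"
proof -
  have "laurent_at_1 (Polynomial.poly p 0) = laurent_at_1 (Polynomial.poly p (1 - LA))"
    by (cases p) (simp add: laurent_at_1_add laurent_at_1_mult laurent_at_1_diff laurent_at_1_LA)
  then obtain w where "fp_fst w = Polynomial.poly p 0" "fp_snd w = Polynomial.poly p (1 - LA)"
    by (rule fp_exists)
  then have "\<exists>!w. fp_fst w = Polynomial.poly p 0 \<and> fp_snd w = Polynomial.poly p (1 - LA)"
    by (intro ex1I[of _ w]) (auto intro: fp_eqI)
  from theI'[OF this]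
  show "fp_fst (E_values p) = Polynomial.poly p 0" "fp_snd (E_values p) = Polynomial.poly p (1 - LA)"
    unfolding E_values_def by auto
qed

lemma E_values_surj: "surj E_values"
  unfolding surj_def
proof
  fix w
  have "w = E_values [:fp_fst w, fp_quot w:]"
    by (rule fp_eqI) (simp_all add: E_values fp_quot[of w])
  then show "\<exists>p. w = E_values p" ..
qed

lemma rack_relation_eq: "rack_relation = [:0, 1:] * [:- (1 - LA), 1:]"
  by (simp add: rack_relation_def power2_eq_square)

text \<open>A polynomial with root 0 is \<open>E q\<close>, and its value at \<open>1 - A\<close> is \<open>(1 - A) q(1 - A)\<close>.
  Cancelling \<open>1 - A\<close> shows that \<open>1 - A\<close> is a root of q.\<close>

lemma E_values_eq_0_iff: "E_values p = 0 \<longleftrightarrow> rack_relation dvd p"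
proof
  assume "E_values p = 0"
  then have "fp_fst (E_values p) = 0" "fp_snd (E_values p) = 0"
    by simp_all
  then have p0: "Polynomial.poly p 0 = 0" and pe: "Polynomial.poly p (1 - LA) = 0"
    by (simp_all only: E_values)
  have "[:- 0, 1:] dvd p"
    using p0 by (simp only: poly_eq_0_iff_dvd)
  then obtain q where q: "p = [:0, 1:] * q"
    by auto
  have "(1 - LA) * Polynomial.poly q (1 - LA) = 0"
    using pe by (simp add: q)
  then have "Polynomial.poly q (1 - LA) = 0"
    using LA_neq_1 by (metis mult_eq_0_iff)
  then have "[:- (1 - LA), 1:] dvd q"
    by (simp only: poly_eq_0_iff_dvd)
  then show "rack_relation dvd p"
    unfolding rack_relation_eq q by (rule mult_dvd_mono[OF dvd_refl])
next
  assume "rack_relation dvd p"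
  then obtain q where "p = [:0, 1:] * [:- (1 - LA), 1:] * q"
    unfolding rack_relation_eq ..
  then show "E_values p = 0"
    by (intro fp_eqI) (simp_all add: E_values algebra_simps)
qed

lemma E_values_ring_hom_ring: "ring_hom_ring LaurentE_ring Fibre_ring E_values"
  by (intro ring_hom_ringI2 ring_from_type_algebra ring_hom_memI fp_eqI) (simp_all add: E_values)

lemma kernel_E_values: "a_kernel LaurentE_ring Fibre_ring E_values = PIdl\<^bsub>LaurentE_ring\<^esub> rack_relation"
  by (auto simp: a_kernel_def' cgenideal_def E_values_eq_0_iff dvd_def mult.commute)

definition E_values_class :: "laurent poly set \<Rightarrow> fibre_product"
  where "E_values_class C = the_elem (E_values ` C)"

lemma E_values_class_ring_iso: "E_values_class \<in> ring_iso AE_quotient Fibre_ring"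
proof -
  interpret ring_hom_ring LaurentE_ring Fibre_ring E_values by (rule E_values_ring_hom_ring)
  have "(\<lambda>C. the_elem (E_values ` C)) \<in> ring_iso (LaurentE_ring Quot a_kernel LaurentE_ring Fibre_ring E_values) Fibre_ring"
    by (rule FactRing_iso_set) (simp add: E_values_surj)
  then show ?thesis
    by (simp add: AE_quotient_def kernel_E_values E_values_class_def[abs_def])
qed

lemma ring_AE_quotient: "ring AE_quotient"
proof -
  interpret cring LaurentE_ring by (rule cring_from_type_algebra)
  show ?thesis
    unfolding AE_quotient_def by (rule ideal.quotient_is_ring[OF cgenideal_ideal]) simp
qed

text \<open>The pair of substitutions is constant on a residue class, hence so is each component.\<close>

lemma subst_E_eq:
  assumes "C \<in> carrier AE_quotient"
  shows "subst_E 0 C = fp_fst (E_values_class C)" "subst_E (1 - LA) C = fp_snd (E_values_class C)"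
proof -
  interpret ring_hom_ring LaurentE_ring Fibre_ring E_values by (rule E_values_ring_hom_ring)
  obtain w where w: "E_values ` C = {w}"
    using the_elem_wf[of C] assms by (auto simp: AE_quotient_def kernel_E_values)
  have "(\<lambda>p. Polynomial.poly p 0) ` C = fp_fst ` E_values ` C"
    "(\<lambda>p. Polynomial.poly p (1 - LA)) ` C = fp_snd ` E_values ` C"
    by (simp_all add: image_image E_values)
  then show "subst_E 0 C = fp_fst (E_values_class C)" "subst_E (1 - LA) C = fp_snd (E_values_class C)"
    by (simp_all add: subst_E_def E_values_class_def w)
qed


section \<open>Abelian racks as modules\<close>

definition rack_E :: "'m::abelian_rack \<Rightarrow> 'm"
  where "rack_E x = x \<rhd> 0"

definition rack_A :: "'m::abelian_rack \<Rightarrow> 'm"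
  where "rack_A x = 0 \<rhd> x"

text \<open>Since \<open>(x, y) = (x, 0) + (0, y)\<close>, an additive rack operation is determined by the two
  operators.\<close>

lemma rhd_eq: "x \<rhd> y = rack_E x + rack_A (y :: 'm::abelian_rack)"
  using abelian_rack_class.rhd_add[of x 0 0 y] by (simp add: rack_E_def rack_A_def)

lemma rack_E_add: "rack_E (x + y) = rack_E x + rack_E (y :: 'm::abelian_rack)"
  using abelian_rack_class.rhd_add[of x y 0 0] by (simp add: rack_E_def)

lemma rack_A_add: "rack_A (x + y) = rack_A x + rack_A (y :: 'm::abelian_rack)"
  using abelian_rack_class.rhd_add[of 0 0 x y] by (simp add: rack_A_def)

lemma rack_A_0: "rack_A 0 = (0 :: 'm::abelian_rack)"
  using rack_A_add[of 0 0] by simp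

lemma inj_rack_A: "rack_A x = rack_A (y :: 'm::abelian_rack) \<longleftrightarrow> x = y"
  unfolding rack_A_def by (metis rdiv_rhd)

lemma rack_A_E: "rack_A (rack_E x) = rack_E (rack_A (x :: 'm::abelian_rack))"
  using rhd_rhd[of 0 x 0] rack_A_0[where 'm='m] by (simp add: rack_E_def rack_A_def)

text \<open>The relation \<open>E^2 = E (1 - A)\<close> is self-distributivity \<open>x \<rhd> (y \<rhd> z) = (x \<rhd> y) \<rhd> (x \<rhd> z)\<close> at
  \<open>y = z = 0\<close>.\<close>

lemma rack_E_E: "rack_E (rack_E x) + rack_A (rack_E x) = rack_E (x :: 'm::abelian_rack)"
proof -
  have "rack_E x = x \<rhd> (0 \<rhd> 0)"
    using rack_A_0[where 'm='m] by (simp add: rack_E_def rack_A_def)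
  also have "\<dots> = rack_E x \<rhd> rack_E x"
    by (subst rhd_rhd) (simp add: rack_E_def)
  finally show ?thesis by (simp add: rhd_eq)
qed

lemma abelian_rack_homI:
  assumes "\<And>x y. f (x + y) = f x + f y" "\<And>x. f (rack_E x) = rack_E (f x)"
    "\<And>x. f (rack_A x) = rack_A (f x)"
  shows "abelian_rack_hom f"
  by (simp add: abelian_rack_hom_def rack_hom_def rhd_eq assms)

lemma abelian_rack_homD:
  assumes "abelian_rack_hom f"
  shows "f (x + y) = f x + f y" "f 0 = 0" "f (rack_E x) = rack_E (f x)"
    "f (rack_A x) = rack_A (f x)"
proof -
  show add: "f (x + y) = f x + f y" for x y
    using assms by (simp add: abelian_rack_hom_def)
  show "f 0 = 0" using add[of 0 0] by simp
  then show "f (rack_E x) = rack_E (f x)" "f (rack_A x) = rack_A (f x)"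
    using assms by (auto simp: abelian_rack_hom_def rack_hom_def rack_E_def rack_A_def)
qed

text \<open>One of the two intervals is empty, depending on the sign of n.\<close>

definition int_multiple :: "int \<Rightarrow> 'a::ab_group_add \<Rightarrow> 'a"
  where "int_multiple n x = (\<Sum>_\<in>{0..<n}. x) - (\<Sum>_\<in>{n..<0}. x)"

lemma int_multiple_simps [simp]: "int_multiple 0 x = 0" "int_multiple 1 x = x"
  using atLeastLessThanPlusOne_atLeastAtMost_int[of 0 0] by (simp_all add: int_multiple_def)

lemma int_multiple_succ: "int_multiple (n + 1) x = int_multiple n x + x"
proof (cases "0 \<le> n")
  case True
  then have "{0..<n + 1} = insert n {0..<n}" "{n + 1..<0} = {}" "{n..<0} = {}"
    by auto
  then show ?thesis by (simp add: int_multiple_def)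
next
  case False
  then have "{n..<0} = insert n {n + 1..<0}" "{0..<n + 1} = {}" "{0..<n} = {}"
    by auto
  then show ?thesis by (simp add: int_multiple_def)
qed

lemma int_multiple_add: "int_multiple (m + n) x = int_multiple m x + int_multiple n x"
proof (induction n rule: int_induct[of _ 0])
  case (step1 n)
  then show ?case
    using int_multiple_succ[of "m + n" x] int_multiple_succ[of n x] by (simp add: add.assoc)
next
  case (step2 n)
  then show ?case
    using int_multiple_succ[of "m + n - 1" x] int_multiple_succ[of "n - 1" x]
    by (simp add: algebra_simps)
qed simp

definition rack_A_power :: "int \<Rightarrow> 'm::abelian_rack \<Rightarrow> 'm"
  where "rack_A_power n = (if 0 \<le> n then rack_A ^^ nat n else rdiv 0 ^^ nat (- n))"

lemma rack_A_power_succ: "rack_A_power (n + 1) x = rack_A (rack_A_power n x)"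
proof (cases "0 \<le> n")
  case True
  then show ?thesis by (simp add: rack_A_power_def nat_add_distrib)
next
  case False
  then have "nat (- n) = Suc (nat (- (n + 1)))" by simp
  with False show ?thesis by (cases "n = - 1") (simp_all add: rack_A_power_def rack_A_def)
qed

text \<open>The module structure over the Laurent polynomials, where A acts as \<open>rack_A\<close>.\<close>

definition laurent_act :: "laurent \<Rightarrow> 'm::abelian_rack \<Rightarrow> 'm"
  where "laurent_act p x =
    (\<Sum>n\<in>Poly_Mapping.keys p. int_multiple (Poly_Mapping.lookup p n) (rack_A_power n x))"

lemma laurent_act_superset:
  assumes "finite K" "Poly_Mapping.keys p \<subseteq> K"
  shows "laurent_act p x = (\<Sum>n\<in>K. int_multiple (Poly_Mapping.lookup p n) (rack_A_power n x))"
  unfolding laurent_act_def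
  by (rule sum.mono_neutral_left) (use assms in \<open>auto simp: in_keys_iff\<close>)

lemma laurent_act_add: "laurent_act (p + q) x = laurent_act p x + laurent_act q x"
  using Poly_Mapping.keys_add[of p q]
  by (simp add: laurent_act_superset[of "Poly_Mapping.keys p \<union> Poly_Mapping.keys q"]
      lookup_add int_multiple_add sum.distrib)

lemma laurent_act_monomial: "laurent_act (Poly_Mapping.single n 1) x = rack_A_power n x"
  by (simp add: laurent_act_def)

lemma laurent_act_1: "laurent_act 1 x = x"
  using laurent_act_monomial[of 0 x] by (simp add: rack_A_power_def)

lemma additive_diff:
  fixes f :: "'a::ab_group_add \<Rightarrow> 'b::ab_group_add"
  assumes "\<And>x y. f (x + y) = f x + f y"
  shows "f 0 = 0" "f (x - y) = f x - f y"
  using assms[of 0 0] assms[of "x - y" y] by simp_all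

lemmas laurent_act_diff = additive_diff[of "\<lambda>p. laurent_act p x" for x, OF laurent_act_add]
lemmas rack_A_diff = additive_diff[of rack_A, OF rack_A_add]
lemmas rack_E_diff = additive_diff[of rack_E, OF rack_E_add]

lemma laurent_act_LA: "laurent_act (LA * p) x = rack_A (laurent_act p x)"
  by (induction p rule: laurent_induct)
    (simp_all add: laurent_act_diff rack_A_diff LA_mult_single laurent_act_monomial
      rack_A_power_succ right_diff_distrib)

text \<open>The Laurent polynomials are the free module on 1, so an additive map that
  commutes with A is determined by its value at 1. Negative powers of A are reached because A is
  injective on the target. This identifies the module structures that occur below.\<close>

lemma laurent_act_unique:
  fixes \<phi> :: "laurent \<Rightarrow> 'm::abelian_rack"
  assumes add: "\<And>p q. \<phi> (p + q) = \<phi> p + \<phi> q" and LA: "\<And>p. \<phi> (LA * p) = rack_A (\<phi> p)"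
  shows "\<phi> p = laurent_act p (\<phi> 1)"
proof (induction p rule: laurent_induct)
  case (monomial n)
  show ?case
  proof (induction n rule: int_induct[of _ 0])
    case base
    show ?case by (simp add: laurent_act_1)
  next
    case (step1 n)
    then show ?case
      using LA laurent_act_LA[of _ "\<phi> 1"] by (metis LA_mult_single)
  next
    case (step2 n)
    have "rack_A (\<phi> (Poly_Mapping.single (n - 1) 1))
        = rack_A (laurent_act (Poly_Mapping.single (n - 1) 1) (\<phi> 1))"
      using step2 by (simp add: LA_mult_single flip: LA laurent_act_LA)
    then show ?case by (simp add: inj_rack_A)
  qed
qed (simp_all add: additive_diff[of \<phi>, OF add] laurent_act_diff)

lemma laurent_act_hom:
  assumes "abelian_rack_hom f"
  shows "f (laurent_act p x) = laurent_act p (f x)"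
  using laurent_act_unique[of "\<lambda>p. f (laurent_act p x)" p]
  by (simp add: laurent_act_add laurent_act_LA laurent_act_1 abelian_rack_homD[OF assms])


section \<open>The free abelian rack of rank 1\<close>

type_synonym free_abelian_rack_1 = "unit free_rack abelianization"

definition free_gen :: free_abelian_rack_1
  where "free_gen = abelianization_unit (free_rack_gen ())"

text \<open>The composite of two left adjoints: extend along the free rack, then along the
  abelianization.\<close>

lemma free_abelian_rack_1_universal:
  fixes w :: "'m::abelian_rack"
  shows "\<exists>!f :: free_abelian_rack_1 \<Rightarrow> 'm. abelian_rack_hom f \<and> f free_gen = w"
proof -
  obtain r :: "unit free_rack \<Rightarrow> 'm" where r: "rack_hom r" "r (free_rack_gen ()) = w"
    and r_unique: "\<And>s. rack_hom s \<Longrightarrow> s (free_rack_gen ()) = w \<Longrightarrow> s = r"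
    using free_rack_universal[of "\<lambda>_::unit. w"] by auto
  obtain f :: "free_abelian_rack_1 \<Rightarrow> 'm"
    where f: "abelian_rack_hom f" "\<forall>a. f (abelianization_unit a) = r a"
    and f_unique: "\<And>g. abelian_rack_hom g \<Longrightarrow> \<forall>a. g (abelianization_unit a) = r a \<Longrightarrow> g = f"
    using abelianization_universal[OF r(1)] by blast
  show ?thesis
  proof (rule ex1I[of _ f])
    show "abelian_rack_hom f \<and> f free_gen = w"
      using f r(2) by (simp add: free_gen_def)
  next
    fix g :: "free_abelian_rack_1 \<Rightarrow> 'm"
    assume g: "abelian_rack_hom g \<and> g free_gen = w"
    have "rack_hom (abelianization_unit :: unit free_rack \<Rightarrow> _)"
      by (rule rack_hom_abelianization_unit)
    then have "rack_hom (\<lambda>a. g (abelianization_unit a))"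
      using g by (auto simp: rack_hom_def abelian_rack_hom_def)
    then have "(\<lambda>a. g (abelianization_unit a)) = r"
      by (rule r_unique) (use g in \<open>simp add: free_gen_def\<close>)
    then show "g = f"
      using g by (intro f_unique) (auto dest: fun_cong)
  qed
qed

lemma free_abelian_rack_1_eqI:
  fixes f g :: "free_abelian_rack_1 \<Rightarrow> 'm::abelian_rack"
  assumes "abelian_rack_hom f" "abelian_rack_hom g" "f free_gen = g free_gen"
  shows "f = g"
  using free_abelian_rack_1_universal[of "g free_gen"] assms by blast

lemma abelian_rack_hom_comp:
  "abelian_rack_hom f \<Longrightarrow> abelian_rack_hom g \<Longrightarrow> abelian_rack_hom (f \<circ> g)"
  by (simp add: abelian_rack_hom_def rack_hom_def)

lemma abelian_rack_hom_id: "abelian_rack_hom id"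
  by (simp add: abelian_rack_hom_def rack_hom_def)

definition to_fibre :: "free_abelian_rack_1 \<Rightarrow> fibre_product"
  where "to_fibre = (THE f. abelian_rack_hom f \<and> f free_gen = 1)"

lemma to_fibre: "abelian_rack_hom to_fibre" "to_fibre free_gen = 1"
  using theI'[OF free_abelian_rack_1_universal[of "1 :: fibre_product"]]
  by (auto simp: to_fibre_def)

lemma fp_rack_A_E [simp]:
  "fp_fst (rack_A w) = LA * fp_fst w" "fp_snd (rack_A w) = LA * fp_snd w"
  "fp_fst (rack_E w) = 0" "fp_snd (rack_E w) = (1 - LA) * fp_snd w"
  by (simp_all add: rack_A_def rack_E_def)

lift_definition fp_const :: "laurent \<Rightarrow> fibre_product" is "\<lambda>p. (p, p)" by simp

lemma fp_const [simp]: "fp_fst (fp_const p) = p" "fp_snd (fp_const p) = p"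
  by (transfer; simp)+

lemma fp_laurent_act: "laurent_act p w = fp_const p * w"
proof -
  have "fp_const p * w = laurent_act p (fp_const 1 * w)"
    by (rule laurent_act_unique) (auto intro!: fp_eqI simp: algebra_simps)
  moreover have "fp_const 1 * w = w"
    by (rule fp_eqI) simp_all
  ultimately show ?thesis by simp
qed

lemma fp_quot_simps:
  "fp_quot (v + w) = fp_quot v + fp_quot w"
  "fp_quot (rack_A w) = LA * fp_quot w"
  "fp_quot (rack_E w) = fp_fst w + (1 - LA) * fp_quot w"
  "fp_quot 1 = 0"
  by (rule fp_quot_eqI; simp add: fp_quot[of v] fp_quot[of w] algebra_simps)+

text \<open>In the basis \<open>(1, 1)\<close>, \<open>(0, 1 - A) = E (1, 1)\<close> of the fibre product, \<open>w\<close> has the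
  coordinates \<open>fp_fst w\<close> and \<open>fp_quot w\<close>; the generator takes the place of \<open>(1, 1)\<close>.\<close>

definition from_fibre :: "fibre_product \<Rightarrow> free_abelian_rack_1"
  where "from_fibre w =
    laurent_act (fp_fst w) free_gen + rack_E (laurent_act (fp_quot w) free_gen)"

lemma from_fibre_hom: "abelian_rack_hom from_fibre"
proof (rule abelian_rack_homI)
  fix v w
  show "from_fibre (v + w) = from_fibre v + from_fibre w"
    by (simp add: from_fibre_def fp_quot_simps laurent_act_add rack_E_add)
  show "from_fibre (rack_A w) = rack_A (from_fibre w)"
    by (simp add: from_fibre_def fp_quot_simps laurent_act_LA rack_A_add rack_A_E)
  (* E maps the coordinates (a, c) to (0, a + (1 - A) c), which is the relation E E + A E = E. *)
  let ?x = "laurent_act (fp_fst w) free_gen" and ?y = "laurent_act (fp_quot w) free_gen"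
  have "from_fibre (rack_E w) = rack_E (?x + (?y - rack_A ?y))"
    by (simp add: from_fibre_def fp_quot_simps laurent_act_add laurent_act_diff laurent_act_LA
        left_diff_distrib)
  also have "\<dots> = rack_E ?x + (rack_E ?y - rack_A (rack_E ?y))"
    by (simp add: rack_E_add rack_E_diff rack_A_E)
  also have "\<dots> = rack_E ?x + rack_E (rack_E ?y)"
    using rack_E_E[of ?y] by (simp add: algebra_simps)
  finally show "from_fibre (rack_E w) = rack_E (from_fibre w)"
    by (simp add: from_fibre_def rack_E_add)
qed

text \<open>The composite is an endomorphism that fixes the generator.\<close>

lemma from_to_fibre: "from_fibre (to_fibre x) = x"
proof -
  have "rack_E 0 = (0 :: free_abelian_rack_1)"
    by (rule rack_E_diff)
  then have "from_fibre \<circ> to_fibre = id"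
    by (intro free_abelian_rack_1_eqI abelian_rack_hom_comp abelian_rack_hom_id from_fibre_hom to_fibre)
      (simp add: to_fibre from_fibre_def fp_quot_simps laurent_act_1 laurent_act_diff)
  then show ?thesis by (metis comp_apply id_apply)
qed

lemma to_from_fibre: "to_fibre (from_fibre w) = w"
  by (rule fp_eqI)
    (simp_all add: from_fibre_def abelian_rack_homD[OF to_fibre(1)] laurent_act_hom[OF to_fibre(1)]
      to_fibre(2) fp_laurent_act fp_quot[of w])

text \<open>Multiplications of the commutative ring are rack homomorphisms, as they commute with A
  and E. So both sides are homomorphisms in \<open>x\<close>, and they agree at the generator, which goes
  to 1. This is what turns composition of endomorphisms into multiplication.\<close>

lemma to_fibre_endomorphism:
  assumes "abelian_rack_hom f"
  shows "to_fibre (f x) = to_fibre (f free_gen) * to_fibre x"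
proof -
  let ?w = "to_fibre (f free_gen)"
  have "abelian_rack_hom (\<lambda>v. ?w * v)"
    by (rule abelian_rack_homI; rule fp_eqI; simp add: algebra_simps)
  then have "to_fibre \<circ> f = (\<lambda>v. ?w * v) \<circ> to_fibre"
    by (intro free_abelian_rack_1_eqI abelian_rack_hom_comp assms to_fibre(1))
      (simp_all add: to_fibre(2))
  then show ?thesis by (metis comp_apply)
qed


section \<open>The ring of abelian racks\<close>

text \<open>Sums of homomorphisms are homomorphisms because the rack operation is additive.\<close>

lemma ring_abelian_rack_End: "ring (abelian_rack_End :: ('m::abelian_rack \<Rightarrow> 'm) ring)"
proof (rule ringI)
  have neg: "abelian_rack_hom (\<lambda>x. - f x)" if f: "abelian_rack_hom f" for f :: "'m \<Rightarrow> 'm"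
  proof (rule abelian_rack_homI)
    show "- f (x + y) = - f x + - f y" for x y
      by (simp add: abelian_rack_homD[OF f])
    show "- f (rack_E x) = rack_E (- f x)" "- f (rack_A x) = rack_A (- f x)" for x
      using rack_E_diff(2)[of 0 "f x"] rack_A_diff(2)[of 0 "f x"]
      by (simp_all add: abelian_rack_homD[OF f] rack_E_diff(1) rack_A_diff(1))
  qed
  show "abelian_group (abelian_rack_End :: ('m \<Rightarrow> 'm) ring)"
  proof (rule abelian_groupI)
    fix f :: "'m \<Rightarrow> 'm"
    assume "f \<in> carrier abelian_rack_End"
    then show "\<exists>g\<in>carrier abelian_rack_End.
        g \<oplus>\<^bsub>abelian_rack_End\<^esub> f = \<zero>\<^bsub>abelian_rack_End\<^esub>"
      using neg by (intro bexI[of _ "\<lambda>x. - f x"]) (auto simp: abelian_rack_End_def)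
  qed (auto simp: abelian_rack_End_def add.assoc add.commute abelian_rack_homD rack_E_add
      rack_A_add rack_E_diff(1) rack_A_diff(1) add_ac intro!: abelian_rack_homI)
  show "Group.monoid (abelian_rack_End :: ('m \<Rightarrow> 'm) ring)"
    by (rule monoidI)
      (auto simp: abelian_rack_End_def abelian_rack_hom_comp abelian_rack_hom_id comp_assoc)
qed (auto simp: abelian_rack_End_def fun_eq_iff abelian_rack_homD)

definition Racks_ab_to_fibre :: "(free_abelian_rack_1 \<Rightarrow> free_abelian_rack_1) \<Rightarrow> fibre_product"
  where "Racks_ab_to_fibre f = to_fibre (f free_gen)"

text \<open>Freeness makes evaluation at the generator a bijection from the endomorphisms to the
  free abelian rack, and the latter is identified with the fibre product.\<close>

lemma Racks_ab_to_fibre_ring_iso: "Racks_ab_to_fibre \<in> ring_iso Racks_ab Fibre_ring"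
proof (rule ring_iso_memI)
  fix f g
  assume "f \<in> carrier Racks_ab" "g \<in> carrier Racks_ab"
  then have f: "abelian_rack_hom f" and g: "abelian_rack_hom g"
    by (simp_all add: Racks_ab_def abelian_rack_End_def)
  show "Racks_ab_to_fibre (f \<otimes>\<^bsub>Racks_ab\<^esub> g)
      = Racks_ab_to_fibre f \<otimes>\<^bsub>Fibre_ring\<^esub> Racks_ab_to_fibre g"
    using to_fibre_endomorphism[OF f, of "g free_gen"]
    by (simp add: Racks_ab_to_fibre_def Racks_ab_def abelian_rack_End_def)
  show "Racks_ab_to_fibre (f \<oplus>\<^bsub>Racks_ab\<^esub> g)
      = Racks_ab_to_fibre f \<oplus>\<^bsub>Fibre_ring\<^esub> Racks_ab_to_fibre g"
    by (simp add: Racks_ab_to_fibre_def Racks_ab_def abelian_rack_End_def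
        abelian_rack_homD[OF to_fibre(1)])
next
  show "bij_betw Racks_ab_to_fibre (carrier Racks_ab) (carrier Fibre_ring)"
  proof (rule bij_betw_imageI)
    show "inj_on Racks_ab_to_fibre (carrier Racks_ab)"
    proof (rule inj_onI)
      fix f g
      assume fg: "f \<in> carrier Racks_ab" "g \<in> carrier Racks_ab"
        "Racks_ab_to_fibre f = Racks_ab_to_fibre g"
      then have "f free_gen = g free_gen"
        unfolding Racks_ab_to_fibre_def by (metis from_to_fibre)
      with fg show "f = g"
        by (auto simp: Racks_ab_def abelian_rack_End_def intro: free_abelian_rack_1_eqI)
    qed
    have "w \<in> Racks_ab_to_fibre ` carrier Racks_ab" for w
    proof -
      obtain f :: "free_abelian_rack_1 \<Rightarrow> free_abelian_rack_1"
        where "abelian_rack_hom f" "f free_gen = from_fibre w"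
        using free_abelian_rack_1_universal[of "from_fibre w"] by blast
      then show ?thesis
        by (intro image_eqI[of _ _ f])
          (simp_all add: Racks_ab_to_fibre_def to_from_fibre Racks_ab_def abelian_rack_End_def)
    qed
    then show "Racks_ab_to_fibre ` carrier Racks_ab = carrier Fibre_ring"
      by auto
  qed
qed (simp_all add: Racks_ab_to_fibre_def Racks_ab_def abelian_rack_End_def to_fibre(2))

theorem proposition2p19:
  shows "Racks_ab \<simeq> AE_quotient \<and>
    is_ring_pullback TYPE('t) Laurent_ring Laurent_ring \<Z> laurent_at_1 laurent_at_1
      AE_quotient (subst_E 0) (subst_E (1 - LA)) \<and>
    (\<forall>\<theta>\<in>ring_iso Racks_ab AE_quotient.
       is_ring_pullback TYPE('t) Laurent_ring Laurent_ring \<Z> laurent_at_1 laurent_at_1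
         Racks_ab (subst_E 0 \<circ> \<theta>) (subst_E (1 - LA) \<circ> \<theta>))"
proof (intro conjI ballI)
  have "inv_into (carrier AE_quotient) E_values_class \<in> ring_iso Fibre_ring AE_quotient"
    by (rule ring_iso_set_sym[OF ring_AE_quotient E_values_class_ring_iso])
  then show "Racks_ab \<simeq> AE_quotient"
    unfolding is_ring_iso_def using ring_iso_set_trans[OF Racks_ab_to_fibre_ring_iso] by blast
  show "is_ring_pullback TYPE('t) Laurent_ring Laurent_ring \<Z> laurent_at_1 laurent_at_1
      AE_quotient (subst_E 0) (subst_E (1 - LA))"
    by (rule is_ring_pullback_of_ring_iso[OF ring_AE_quotient E_values_class_ring_iso])
      (simp_all add: subst_E_eq)
  fix \<theta>
  assume \<theta>: "\<theta> \<in> ring_iso Racks_ab AE_quotient"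
  have "ring Racks_ab"
    unfolding Racks_ab_def by (rule ring_abelian_rack_End)
  then show "is_ring_pullback TYPE('t) Laurent_ring Laurent_ring \<Z> laurent_at_1 laurent_at_1
      Racks_ab (subst_E 0 \<circ> \<theta>) (subst_E (1 - LA) \<circ> \<theta>)"
    by (rule is_ring_pullback_of_ring_iso[OF _ ring_iso_set_trans[OF \<theta> E_values_class_ring_iso]])
      (simp_all add: subst_E_eq ring_iso_memE(1)[OF \<theta>])
qed

end
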